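(* Let $X$ be a right quaternionic Banach space and $T:D(T)\subseteq X\to X$ a closed right linear operator. Assume that there exists $\omega\in[0,\pi]$ such that $S_\omega:=\{te^{i\omega}\mid t>0,\ i\in\mathbb{S}\}\subseteq\rho_S(T)$, and that there exists $M\ge 0$ such that $$\|Q_s^{-1}(T)\|\le\frac{M}{|s|^2}\quad\text{and}\quad\|TQ_s^{-1}(T)\|\le\frac{M}{|s|},\qquad s\in S_\omega.$$ Then for all $n,k,m\in\mathbb{N}_0$ with $n<k<m$ there holds $$D(T^k)\in K_{\frac{k-n}{m-n}}\big(D(T^n),D(T^m)\big),$$ i.e. there exists some $C_{n,k,m}\ge 0$ such that $$K(t,x)\le C_{n,k,m}\,t^{\frac{k-n}{m-n}}\,\|x\|_{D(T^k)},\qquad t>0,\ x\in D(T^k),$$ where $K$ is the $K$-functional of the couple $D(T^n),D(T^m)$.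
   Context: Quaternions: $\mathbb{H}$ denotes the quaternions $s=s_0+s_1e_1+s_2e_2+s_3e_3$ with $\mathrm{Re}(s)=s_0$ and modulus $|s|=\sqrt{s_0^2+s_1^2+s_2^2+s_3^2}$; $\mathbb{S}:=\{s\in\mathbb{H}\mid s_0=0,\ |s|=1\}$ is the sphere of imaginary units, and $e^{i\omega}:=\cos\omega+i\sin\omega$ for $i\in\mathbb{S}$. Right quaternionic Banach space: a right vector space $X$ over $\mathbb{H}$ (scalar multiplication from the right) with a norm satisfying $\|xs\|=\|x\||s|$ for $x\in X,s\in\mathbb{H}$, the triangle inequality and definiteness, complete with respect to this norm. Operators: a right linear operator $T:D(T)\subseteq X\to X$ is defined on a right linear subspace $D(T)$ (not assumed dense) and satisfies $T(x+y)=Tx+Ty$, $T(xs)=(Tx)s$ for $x,y\in D(T)$, $s\in\mathbb{H}$. For real $\lambda$, $(\lambda T)(x):=(T\lambda)(x):=T(x)\lambda$ with domain $D(T)$. $T$ is closed if $D(T)$ is complete with respect to $\|x\|_{D(T)}:=\|x\|+\|Tx\|$. $\mathcal{B}(X)$ denotes the everywhere defined bounded right linear operators on $X$. Powers $T^n$ have their natural domains, with $T^0=I$, $D(T^0)=X$; $D(T^n)$ carries the norm $\|x\|_{D(T^n)}:=\|x\|+\|T^nx\|$. $S$-spectrum: for $s\in\mathbb{H}$, $Q_s(T):=T^2-2s_0T+|s|^2$ with $D(Q_s(T)):=D(T^2)$. The $S$-resolvent set is $\rho_S(T):=\{s\in\mathbb{H}\mid Q_s^{-1}(T)\in\mathcal{B}(X)\}$,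 i.e. $Q_s(T):D(T^2)\to X$ is bijective with bounded inverse $Q_s^{-1}(T)$. Intermediate spaces: $V\hookrightarrow W$ means $V\subseteq W$ and there is $C\ge0$ with $\|v\|_W\le C\|v\|_V$ for all $v\in V$. Two right Banach spaces $Y_0,Y_1$ form an interpolation couple if both are continuously embedded in a common topological Hausdorff space; then $\|x\|_{Y_0\cap Y_1}:=\max\{\|x\|_{Y_0},\|x\|_{Y_1}\}$ and $\|x\|_{Y_0+Y_1}:=\inf\{\|a\|_{Y_0}+\|b\|_{Y_1}\mid x=a+b,\ a\in Y_0,\ b\in Y_1\}$. The $K$-functional of the couple $Y_0,Y_1$ is $K(t,x):=\inf\{\|a\|_{Y_0}+t\|b\|_{Y_1}\mid x=a+b,\ a\in Y_0,\ b\in Y_1\}$ for $t>0$, $x\in Y_0+Y_1$. For $\theta\in(0,1)$ and a right Banach space $E$ with $Y_0\cap Y_1\hookrightarrow E\hookrightarrow Y_0+Y_1$, we say $E\in K_\theta(Y_0,Y_1)$ if there exists $C_K\ge0$ such that $K(t,x)\le C_Kt^\theta\|x\|_E$ for all $t>0$, $x\in E$. *)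

theory Defs
  imports "HOL-Analysis.Analysis"
begin

section \<open>Quaternions\<close>

datatype quat = Quat (qre: real) (qim1: real) (qim2: real) (qim3: real)

lemma quat_eqI:
  "qre s = qre t \<Longrightarrow> qim1 s = qim1 t \<Longrightarrow> qim2 s = qim2 t \<Longrightarrow> qim3 s = qim3 t \<Longrightarrow> s = t"
  by (cases s; cases t) simp

lemma quat_eq_iff:
  "s = t \<longleftrightarrow> qre s = qre t \<and> qim1 s = qim1 t \<and> qim2 s = qim2 t \<and> qim3 s = qim3 t"
  using quat_eqI by auto

instantiation quat :: real_vector
begin

definition zero_quat where "0 = Quat 0 0 0 0"

definition plus_quat where
  "s + t = Quat (qre s + qre t) (qim1 s + qim1 t) (qim2 s + qim2 t) (qim3 s + qim3 t)"

definition uminus_quat where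
  "- s = Quat (- qre s) (- qim1 s) (- qim2 s) (- qim3 s)"

definition minus_quat where
  "s - t = Quat (qre s - qre t) (qim1 s - qim1 t) (qim2 s - qim2 t) (qim3 s - qim3 t)"

definition scaleR_quat where
  "scaleR r s = Quat (r * qre s) (r * qim1 s) (r * qim2 s) (r * qim3 s)"

lemma quat_sel_linear [simp]:
  "qre 0 = 0" "qim1 0 = 0" "qim2 0 = 0" "qim3 0 = 0"
  "qre (s + t) = qre s + qre t" "qim1 (s + t) = qim1 s + qim1 t"
  "qim2 (s + t) = qim2 s + qim2 t" "qim3 (s + t) = qim3 s + qim3 t"
  "qre (- s) = - qre s" "qim1 (- s) = - qim1 s"
  "qim2 (- s) = - qim2 s" "qim3 (- s) = - qim3 s"
  "qre (s - t) = qre s - qre t" "qim1 (s - t) = qim1 s - qim1 t"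
  "qim2 (s - t) = qim2 s - qim2 t" "qim3 (s - t) = qim3 s - qim3 t"
  "qre (r *\<^sub>R s) = r * qre s" "qim1 (r *\<^sub>R s) = r * qim1 s"
  "qim2 (r *\<^sub>R s) = r * qim2 s" "qim3 (r *\<^sub>R s) = r * qim3 s"
  by (simp_all add: zero_quat_def plus_quat_def uminus_quat_def minus_quat_def scaleR_quat_def)

instance
  by standard (simp_all add: quat_eq_iff algebra_simps)

end

instantiation quat :: real_inner
begin

definition inner_quat where
  "inner (s::quat) t = qre s * qre t + qim1 s * qim1 t + qim2 s * qim2 t + qim3 s * qim3 t"

definition norm_quat where
  "norm (s::quat) = sqrt ((qre s)\<^sup>2 + (qim1 s)\<^sup>2 + (qim2 s)\<^sup>2 + (qim3 s)\<^sup>2)"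

definition sgn_quat where
  "sgn (s::quat) = s /\<^sub>R norm s"

definition dist_quat where
  "dist (s::quat) t = norm (s - t)"

definition uniformity_quat where
  "(uniformity :: (quat \<times> quat) filter) = (INF e\<in>{0<..}. principal {(s, t). dist s t < e})"

definition open_quat where
  "open (U :: quat set) \<longleftrightarrow> (\<forall>x\<in>U. \<forall>\<^sub>F (x', y) in uniformity. x' = x \<longrightarrow> y \<in> U)"

instance
proof
  fix s t u :: quat and r :: real
  show "inner s s = 0 \<longleftrightarrow> s = 0"
    unfolding inner_quat_def quat_eq_iff
    by (smt (verit) mult_eq_0_iff quat_sel_linear zero_le_square)
qed (simp_all add: inner_quat_def norm_quat_def sgn_quat_def dist_quat_def uniformity_quat_def
      open_quat_def power2_eq_square algebra_simps)

end

instantiation quat :: real_normed_div_algebra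
begin

definition one_quat where "1 = Quat 1 0 0 0"

definition times_quat where
  "s * t = Quat
     (qre s * qre t - qim1 s * qim1 t - qim2 s * qim2 t - qim3 s * qim3 t)
     (qre s * qim1 t + qim1 s * qre t + qim2 s * qim3 t - qim3 s * qim2 t)
     (qre s * qim2 t - qim1 s * qim3 t + qim2 s * qre t + qim3 s * qim1 t)
     (qre s * qim3 t + qim1 s * qim2 t - qim2 s * qim1 t + qim3 s * qre t)"

definition inverse_quat where
  "inverse (s::quat) = Quat (qre s) (- qim1 s) (- qim2 s) (- qim3 s) /\<^sub>R (norm s)\<^sup>2"

definition divide_quat where "(s::quat) div t = s * inverse t"

lemma quat_sel_mult [simp]:
  "qre 1 = 1" "qim1 1 = 0" "qim2 1 = 0" "qim3 1 = 0"
  "qre (s * t) = qre s * qre t - qim1 s * qim1 t - qim2 s * qim2 t - qim3 s * qim3 t"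
  "qim1 (s * t) = qre s * qim1 t + qim1 s * qre t + qim2 s * qim3 t - qim3 s * qim2 t"
  "qim2 (s * t) = qre s * qim2 t - qim1 s * qim3 t + qim2 s * qre t + qim3 s * qim1 t"
  "qim3 (s * t) = qre s * qim3 t + qim1 s * qim2 t - qim2 s * qim1 t + qim3 s * qre t"
  by (simp_all add: one_quat_def times_quat_def)

lemma norm_quat_square:
  "(norm s)\<^sup>2 = (qre s)\<^sup>2 + (qim1 s)\<^sup>2 + (qim2 s)\<^sup>2 + (qim3 s)\<^sup>2"
  by (simp add: norm_quat_def)

instance
proof
  fix s t :: quat
  have mult_conj: "s * Quat (qre s) (- qim1 s) (- qim2 s) (- qim3 s) = (norm s)\<^sup>2 *\<^sub>R 1"
    and conj_mult: "Quat (qre s) (- qim1 s) (- qim2 s) (- qim3 s) * s = (norm s)\<^sup>2 *\<^sub>R 1"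
    unfolding norm_quat_square by (simp_all add: quat_eq_iff power2_eq_square)
  have sR: "a * (r *\<^sub>R b) = r *\<^sub>R (a * b)" "(r *\<^sub>R a) * b = r *\<^sub>R (a * b)" for a b :: quat and r :: real
    by (simp_all add: quat_eq_iff algebra_simps)
  show "s \<noteq> 0 \<Longrightarrow> inverse s * s = 1" "s \<noteq> 0 \<Longrightarrow> s * inverse s = 1"
    by (simp_all add: inverse_quat_def sR mult_conj conj_mult)
  show "inverse (0::quat) = 0"
    by (simp add: inverse_quat_def)
  have "(norm (s * t))\<^sup>2 = (norm s * norm t)\<^sup>2"
    unfolding power_mult_distrib norm_quat_square by simp algebra
  then show "norm (s * t) = norm s * norm t"
    by simp
qed (simp_all add: quat_eq_iff divide_quat_def algebra_simps)

end

definition imag_units :: "quat set" where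
  "imag_units = {i. qre i = 0 \<and> norm i = 1}"

definition quat_expi :: "quat \<Rightarrow> real \<Rightarrow> quat" where
  "quat_expi i \<omega> = of_real (cos \<omega>) + i * of_real (sin \<omega>)"

definition quat_ray_set :: "real \<Rightarrow> quat set" where
  "quat_ray_set \<omega> = {of_real t * quat_expi i \<omega> |t i. 0 < t \<and> i \<in> imag_units}"


section \<open>Right quaternionic vector spaces and Banach spaces\<close>

class right_quat_space = ab_group_add +
  fixes scaleQ :: "'a \<Rightarrow> quat \<Rightarrow> 'a"  (infixl \<open>*\<^sub>Q\<close> 75)
  assumes scaleQ_add_left: "(x + y) *\<^sub>Q s = x *\<^sub>Q s + y *\<^sub>Q s"
    and scaleQ_add_right: "x *\<^sub>Q (s + t) = x *\<^sub>Q s + x *\<^sub>Q t"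
    and scaleQ_scaleQ: "(x *\<^sub>Q s) *\<^sub>Q t = x *\<^sub>Q (s * t)"
    and scaleQ_one: "x *\<^sub>Q 1 = x"

text \<open>The assumption \<open>scaleQ_of_real\<close> only says that the real structure of the class
  \<^class>\<open>banach\<close> is the restriction of the quaternionic one to the real quaternions.\<close>

class right_quat_banach = right_quat_space + banach +
  assumes scaleQ_of_real: "x *\<^sub>Q of_real r = r *\<^sub>R x"
    and norm_scaleQ: "norm (x *\<^sub>Q s) = norm x * norm s"

definition right_subspace :: "'a::right_quat_space set \<Rightarrow> bool" where
  "right_subspace V \<longleftrightarrow>
     0 \<in> V \<and> (\<forall>x\<in>V. \<forall>y\<in>V. x + y \<in> V) \<and> (\<forall>x\<in>V. \<forall>s. x *\<^sub>Q s \<in> V)"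

definition complete_wrt :: "'a::ab_group_add set \<Rightarrow> ('a \<Rightarrow> real) \<Rightarrow> bool" where
  "complete_wrt V N \<longleftrightarrow>
     (\<forall>u. (\<forall>j. u j \<in> V) \<and> (\<forall>e>0. \<exists>J. \<forall>i\<ge>J. \<forall>j\<ge>J. N (u i - u j) < e)
        \<longrightarrow> (\<exists>x\<in>V. (\<lambda>j. N (u j - x)) \<longlonglongrightarrow> 0))"


section \<open>Interpolation couples and the classes \<open>K\<^sub>\<theta>\<close>\<close>

text \<open>Normed spaces with underlying set inside a common ambient type \<open>'a\<close>. The norm is only
  meaningful on \<open>pts Y\<close>; its values elsewhere are never used.\<close>

datatype 'a nspace = NSpace (pts: "'a set") (nrm: "'a \<Rightarrow> real")

definition right_banach :: "'a::right_quat_space nspace \<Rightarrow> bool" where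
  "right_banach Y \<longleftrightarrow>
     right_subspace (pts Y) \<and>
     (\<forall>x\<in>pts Y. 0 \<le> nrm Y x \<and> (nrm Y x = 0 \<longleftrightarrow> x = 0)) \<and>
     (\<forall>x\<in>pts Y. \<forall>y\<in>pts Y. nrm Y (x + y) \<le> nrm Y x + nrm Y y) \<and>
     (\<forall>x\<in>pts Y. \<forall>s. nrm Y (x *\<^sub>Q s) = nrm Y x * norm s) \<and>
     complete_wrt (pts Y) (nrm Y)"

definition cont_embedded :: "'a nspace \<Rightarrow> 'a nspace \<Rightarrow> bool"  (infix \<open>\<hookrightarrow>\<close> 50) where
  "V \<hookrightarrow> W \<longleftrightarrow> pts V \<subseteq> pts W \<and> (\<exists>C\<ge>0. \<forall>v\<in>pts V. nrm W v \<le> C * nrm V v)"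

text \<open>Continuity of the inclusion of \<open>Y\<close> into the ambient type with its own topology.\<close>

definition cont_in_ambient :: "'a::{ab_group_add, topological_space} nspace \<Rightarrow> bool" where
  "cont_in_ambient Y \<longleftrightarrow>
     (\<forall>y\<in>pts Y. \<forall>U. open U \<and> y \<in> U \<longrightarrow>
        (\<exists>e>0. \<forall>z\<in>pts Y. nrm Y (z - y) < e \<longrightarrow> z \<in> U))"

definition interpolation_couple ::
    "'a::{right_quat_space, t2_space} nspace \<Rightarrow> 'a nspace \<Rightarrow> bool" where
  "interpolation_couple Y0 Y1 \<longleftrightarrow>
     right_banach Y0 \<and> right_banach Y1 \<and> cont_in_ambient Y0 \<and> cont_in_ambient Y1"

definition inter_space :: "'a nspace \<Rightarrow> 'a nspace \<Rightarrow> 'a nspace" where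
  "inter_space Y0 Y1 = NSpace (pts Y0 \<inter> pts Y1) (\<lambda>x. max (nrm Y0 x) (nrm Y1 x))"

definition K_functional ::
    "'a::ab_group_add nspace \<Rightarrow> 'a nspace \<Rightarrow> real \<Rightarrow> 'a \<Rightarrow> real" where
  "K_functional Y0 Y1 t x =
     Inf {nrm Y0 a + t * nrm Y1 b |a b. a \<in> pts Y0 \<and> b \<in> pts Y1 \<and> x = a + b}"

definition sum_space :: "'a::ab_group_add nspace \<Rightarrow> 'a nspace \<Rightarrow> 'a nspace" where
  "sum_space Y0 Y1 =
     NSpace {a + b |a b. a \<in> pts Y0 \<and> b \<in> pts Y1}
       (\<lambda>x. Inf {nrm Y0 a + nrm Y1 b |a b. a \<in> pts Y0 \<and> b \<in> pts Y1 \<and> x = a + b})"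

definition K_class ::
    "real \<Rightarrow> 'a::{right_quat_space, t2_space} nspace \<Rightarrow> 'a nspace \<Rightarrow> 'a nspace set" where
  "K_class \<theta> Y0 Y1 = {E.
     0 < \<theta> \<and> \<theta> < 1 \<and> interpolation_couple Y0 Y1 \<and> right_banach E \<and>
     inter_space Y0 Y1 \<hookrightarrow> E \<and> E \<hookrightarrow> sum_space Y0 Y1 \<and>
     (\<exists>C\<ge>0. \<forall>t>0. \<forall>x\<in>pts E. K_functional Y0 Y1 t x \<le> C * t powr \<theta> * nrm E x)}"


section \<open>Operators and the S-spectrum\<close>

text \<open>An operator is a pair of a domain \<open>D\<close> and a function \<open>T\<close> whose values outside \<open>D\<close> are
  irrelevant.\<close>

definition right_linear_op :: "'a::right_quat_space set \<Rightarrow> ('a \<Rightarrow> 'a) \<Rightarrow> bool" where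
  "right_linear_op D T \<longleftrightarrow>
     right_subspace D \<and> (\<forall>x\<in>D. \<forall>y\<in>D. T (x + y) = T x + T y) \<and>
     (\<forall>x\<in>D. \<forall>s. T (x *\<^sub>Q s) = T x *\<^sub>Q s)"

definition closed_op :: "'a::right_quat_banach set \<Rightarrow> ('a \<Rightarrow> 'a) \<Rightarrow> bool" where
  "closed_op D T \<longleftrightarrow> complete_wrt D (\<lambda>x. norm x + norm (T x))"

definition bounded_right_linear :: "('a::right_quat_banach \<Rightarrow> 'a) \<Rightarrow> bool" where
  "bounded_right_linear A \<longleftrightarrow> right_linear_op UNIV A \<and> (\<exists>C. \<forall>x. norm (A x) \<le> C * norm x)"

primrec pow_dom :: "'a set \<Rightarrow> ('a \<Rightarrow> 'a) \<Rightarrow> nat \<Rightarrow> 'a set" where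
  "pow_dom D T 0 = UNIV"
| "pow_dom D T (Suc n) = {x \<in> pow_dom D T n. (T ^^ n) x \<in> D}"

definition pow_space :: "'a::right_quat_banach set \<Rightarrow> ('a \<Rightarrow> 'a) \<Rightarrow> nat \<Rightarrow> 'a nspace" where
  "pow_space D T n = NSpace (pow_dom D T n) (\<lambda>x. norm x + norm ((T ^^ n) x))"

definition Q_op :: "('a::right_quat_banach \<Rightarrow> 'a) \<Rightarrow> quat \<Rightarrow> 'a \<Rightarrow> 'a" where
  "Q_op T s x = (T ^^ 2) x - T x *\<^sub>Q of_real (2 * qre s) + x *\<^sub>Q of_real ((norm s)\<^sup>2)"

text \<open>Inverse of the operator with domain \<open>D(T\<^sup>2)\<close>; meaningful where that operator is bijective onto
  the whole space. For closed \<open>T\<close> the composition \<open>T \<circ> Q_inv D T s\<close> is then bounded by the closed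
  graph theorem, so that \<^const>\<open>onorm\<close> is its genuine operator norm.\<close>

definition Q_inv :: "'a::right_quat_banach set \<Rightarrow> ('a \<Rightarrow> 'a) \<Rightarrow> quat \<Rightarrow> 'a \<Rightarrow> 'a" where
  "Q_inv D T s = inv_into (pow_dom D T 2) (Q_op T s)"

definition S_resolvent_set :: "'a::right_quat_banach set \<Rightarrow> ('a \<Rightarrow> 'a) \<Rightarrow> quat set" where
  "S_resolvent_set D T =
     {s. bij_betw (Q_op T s) (pow_dom D T 2) UNIV \<and> bounded_right_linear (Q_inv D T s)}"

end

theory Submission
  imports Defs
begin

text \<open>For \<open>s\<close> on the ray set put \<open>r = |s|\<close>, \<open>A = Q\<^sub>s(T)\<^sup>-\<^sup>1\<close>, \<open>R = TA\<close> and \<open>P = r\<^sup>2A - 2s\<^sub>0TA\<close>. Then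
  \<open>TR = I - P\<close> everywhere, \<open>RT = I - P\<close> on \<open>D(T)\<close>, and \<open>R\<close>, \<open>P\<close>, \<open>TP\<close> have norms of order
  \<open>1/r\<close>, \<open>1\<close>, \<open>r\<close>. (The hypothesis on \<open>TA\<close> has content only because \<open>TA\<close> is bounded, by the closed
  graph theorem; otherwise \<^const>\<open>onorm\<close> is a junk value.) Split \<open>x = w + (x - w)\<close> with
  \<open>w = (I - P\<^sup>j)\<^sup>l x\<close>. Since \<open>I - P = RT\<close> can be factored \<open>l\<close> times out of \<open>w\<close>, one gets
  \<open>\<parallel>T\<^sup>i w\<parallel> \<lesssim> r\<^sup>-\<^sup>l \<parallel>T\<^sup>i\<^sup>+\<^sup>l x\<parallel>\<close>; since \<open>P\<^sup>j\<close> can be factored out of \<open>x - w\<close>, one gets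
  \<open>\<parallel>T\<^sup>i\<^sup>+\<^sup>j (x - w)\<parallel> \<lesssim> r\<^sup>j \<parallel>T\<^sup>i x\<parallel>\<close>. With \<open>r = 1\<close> this bounds the intermediate powers by
  \<open>\<parallel>T\<^sup>i x\<parallel> \<lesssim> \<parallel>x\<parallel> + \<parallel>T\<^sup>k x\<parallel>\<close>, which yields completeness of \<open>D(T\<^sup>k)\<close> and all embeddings. For \<open>t < 1\<close> the
  choice \<open>l = k - n\<close>, \<open>j = m - k\<close>, \<open>r = t\<^sup>-\<^sup>1\<^sup>/\<^sup>(\<^sup>m\<^sup>-\<^sup>n\<^sup>)\<close> bounds the \<open>K\<close>-functional; for \<open>t \<ge> 1\<close> the
  splitting \<open>x = x + 0\<close> suffices.\<close>

section \<open>The closed graph theorem\<close>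

text \<open>By Baire, some sublevel set of \<open>norm (f x)\<close> is dense in a ball, so every
  point is approximable by points with controlled image. Iterating on the residuals writes
  \<open>x\<close> as a series whose image converges absolutely, and closedness identifies the sum
  of that series with \<open>f x\<close>.\<close>

theorem closed_graph_bounded_linear:
  fixes f :: "'a::banach \<Rightarrow> 'b::banach"
  assumes "linear f"
    and closed: "\<And>u x y. u \<longlonglongrightarrow> x \<Longrightarrow> (\<lambda>i. f (u i)) \<longlonglongrightarrow> y \<Longrightarrow> f x = y"
  shows "bounded_linear f"
proof -
  interpret linear f by fact
  define S where "S i = {x. norm (f x) \<le> real i}" for i
  have "(\<Union>i. closure (S i)) = UNIV"
  proof -
    have "x \<in> closure (S (nat \<lceil>norm (f x)\<rceil>))" for x
      by (rule subsetD[OF closure_subset]) (simp add: S_def of_nat_ceiling)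
    then show ?thesis by blast
  qed
  moreover have "euclidean interior_of \<Union> (range (\<lambda>i. closure (S i))) = {}"
    if "\<And>i. interior (closure (S i)) = {}"
    by (rule Baire_category_alt) (use that completely_metrizable_space_euclidean in auto)
  ultimately obtain i where "interior (closure (S i)) \<noteq> {}"
    by auto
  then obtain x0 e where "0 < e" and ball: "ball x0 e \<subseteq> closure (S i)"
    by (metis ex_in_conv mem_interior)
  \<comment> \<open>Differences of two points of \<open>S i\<close> move the ball to the origin;
    hence the factor 2.\<close>
  have near_small: "\<exists>a. norm (y - a) < \<delta> \<and> norm (f a) \<le> 2 * real i"
    if "norm y < e" "0 < \<delta>" for y \<delta>
  proof -
    have "x0 + y \<in> closure (S i)" "x0 \<in> closure (S i)"
      using ball \<open>0 < e\<close> that by (auto simp: dist_norm)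
    then obtain a b where a: "a \<in> S i" "dist a (x0 + y) < \<delta> / 2"
      and b: "b \<in> S i" "dist b x0 < \<delta> / 2"
      using \<open>0 < \<delta>\<close> unfolding closure_approachable by (meson half_gt_zero)
    have "y - (a - b) = (b - x0) - (a - (x0 + y))"
      by simp
    then have "norm (y - (a - b)) \<le> norm (b - x0) + norm (a - (x0 + y))"
      by (metis norm_triangle_ineq4)
    moreover have "norm (f (a - b)) \<le> 2 * real i"
      using a b norm_triangle_ineq4[of "f a" "f b"] by (simp add: S_def diff)
    ultimately show ?thesis
      using a b by (intro exI[of _ "a - b"]) (simp add: dist_norm)
  qed
  \<comment> \<open>Scaling \<open>y\<close> to norm \<open>e / 2\<close> by \<open>c\<close> and
    dividing the bound \<open>2 * real i\<close> by \<open>c\<close> gives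
    \<open>K * norm y\<close>.\<close>
  define K where "K = 4 * real i / e"
  have near: "\<exists>a. norm (y - a) < \<delta> \<and> norm (f a) \<le> K * norm y" if \<delta>: "0 < \<delta>" for y \<delta>
  proof (cases "y = 0")
    case True
    then show ?thesis using that by (intro exI[of _ 0]) (simp add: zero)
  next
    case False
    define c where "c = e / (2 * norm y)"
    have "0 < c" using False \<open>0 < e\<close> by (simp add: c_def)
    have "norm (c *\<^sub>R y) < e"
      using False \<open>0 < e\<close> by (simp add: c_def)
    then obtain a where a: "norm (c *\<^sub>R y - a) < c * \<delta>" "norm (f a) \<le> 2 * real i"
      using near_small[of "c *\<^sub>R y" "c * \<delta>"] \<open>0 < c\<close> \<delta> by auto
    have "norm (c *\<^sub>R y - a) = c * norm (y - a /\<^sub>R c)"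
      using \<open>0 < c\<close> norm_scaleR[of c "y - a /\<^sub>R c"] by (simp add: scaleR_diff_right)
    then have "norm (y - a /\<^sub>R c) < \<delta>"
      using a \<open>0 < c\<close> by simp
    moreover have "norm (f (a /\<^sub>R c)) \<le> K * norm y"
      using a(2) False \<open>0 < c\<close> \<open>0 < e\<close> by (simp add: scaleR K_def c_def field_simps)
    ultimately show ?thesis by blast
  qed
  define g where "g y \<delta> = (SOME a. norm (y - a) < \<delta> \<and> norm (f a) \<le> K * norm y)" for y \<delta>
  have g: "norm (y - g y \<delta>) < \<delta>" "norm (f (g y \<delta>)) \<le> K * norm y" if "0 < \<delta>" for y \<delta>
    using someI_ex[OF near[OF that]] unfolding g_def by auto
  have bound: "norm (f x) \<le> norm x * (2 * K)" for x
  proof (cases "x = 0")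
    case True
    then show ?thesis by (simp add: zero)
  next
    case False
    \<comment> \<open>\<open>y j\<close> is the residual after \<open>j\<close> approximations and
      \<open>a j\<close> the approximant removed next; the tolerances halve, so the residuals tend
      to 0.\<close>
    define y where "y = rec_nat x (\<lambda>j z. z - g z (norm x * (1/2) ^ Suc j))"
    define a where "a j = g (y j) (norm x * (1/2) ^ Suc j)" for j
    have y_Suc: "y (Suc j) = y j - a j" for j
      by (simp add: y_def a_def)
    have y_bound: "norm (y j) \<le> norm x * (1/2) ^ j" for j
    proof (cases j)
      case 0
      then show ?thesis by (simp add: y_def)
    next
      case (Suc j')
      then show ?thesis
        using g(1)[of "norm x * (1/2) ^ Suc j'" "y j'"] False unfolding Suc y_Suc a_def by simp
    qed
    have a_bound: "norm (f (a j)) \<le> K * norm x * (1/2) ^ j" for j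
    proof -
      have "norm (f (a j)) \<le> K * norm (y j)"
        unfolding a_def using False by (intro g) simp
      also have "\<dots> \<le> K * (norm x * (1/2) ^ j)"
        using \<open>0 < e\<close> by (intro mult_left_mono y_bound) (simp add: K_def)
      finally show ?thesis by (simp add: mult.assoc)
    qed
    have geo: "(\<lambda>j. K * norm x * (1/2) ^ j) sums (K * norm x * 2)"
      using sums_mult[OF geometric_sums[of "1/2 :: real"], of "K * norm x"] by simp
    have summable: "summable (\<lambda>j. f (a j))"
      by (rule summable_comparison_test'[OF sums_summable[OF geo], of 0]) (rule a_bound)
    have partial: "x - y j = (\<Sum>l<j. a l)" for j
      by (induction j) (simp add: y_def, simp add: y_Suc algebra_simps)
    have "y \<longlonglongrightarrow> 0"
    proof (rule Lim_null_comparison)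
      show "\<forall>\<^sub>F j in sequentially. norm (y j) \<le> norm x * (1/2) ^ j"
        using y_bound by simp
      show "(\<lambda>j. norm x * (1/2) ^ j) \<longlonglongrightarrow> 0"
        by (intro tendsto_mult_right_zero LIMSEQ_power_zero) simp
    qed
    then have "(\<lambda>j. x - y j) \<longlonglongrightarrow> x"
      using tendsto_diff[OF tendsto_const] by fastforce
    moreover have "(\<lambda>j. f (x - y j)) \<longlonglongrightarrow> (\<Sum>j. f (a j))"
      unfolding partial sum using summable_LIMSEQ[OF summable] .
    ultimately have "f x = (\<Sum>j. f (a j))"
      by (rule closed)
    also have "norm \<dots> \<le> (\<Sum>j. K * norm x * (1/2) ^ j)"
      by (intro norm_suminf_le a_bound sums_summable[OF geo])
    also have "\<dots> = norm x * (2 * K)"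
      using sums_unique[OF geo] by (simp add: mult_ac)
    finally show ?thesis .
  qed
  show ?thesis
    using bound by unfold_locales blast
qed

section \<open>Powers of right linear operators\<close>

context
  fixes D :: "'a::right_quat_banach set" and T :: "'a \<Rightarrow> 'a"
  assumes lin: "right_linear_op D T"
begin

text \<open>Passage to the real structure, where the closure facts on \<open>subspace\<close>
  apply.\<close>

lemma right_linear_op_subspace: "subspace D"
  unfolding subspace_def
  by (metis lin right_linear_op_def right_subspace_def scaleQ_of_real)

lemma right_linear_op_add: "x \<in> D \<Longrightarrow> y \<in> D \<Longrightarrow> T (x + y) = T x + T y"
  using lin by (simp add: right_linear_op_def)

lemma right_linear_op_scaleQ: "x \<in> D \<Longrightarrow> T (x *\<^sub>Q s) = T x *\<^sub>Q s"
  using lin by (simp add: right_linear_op_def)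

lemma right_linear_op_scaleR: "x \<in> D \<Longrightarrow> T (r *\<^sub>R x) = r *\<^sub>R T x"
  by (metis right_linear_op_scaleQ scaleQ_of_real)

lemma right_linear_op_zero: "T 0 = 0"
  using right_linear_op_scaleR[of 0 0] subspace_0[OF right_linear_op_subspace] by simp

lemma right_linear_op_diff:
  assumes "x \<in> D" "y \<in> D"
  shows "T (x - y) = T x - T y"
  using right_linear_op_add[of "x - y" y] subspace_diff[OF right_linear_op_subspace] assms by simp

lemma right_linear_op_pow_zero: "(T ^^ i) 0 = 0"
  by (induction i) (simp_all add: right_linear_op_zero)

lemma right_linear_op_pow: "right_linear_op (pow_dom D T i) (T ^^ i)"
proof (induction i)
  case 0
  then show ?case by (simp add: right_linear_op_def right_subspace_def)
next
  case (Suc i)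
  then show ?case
    using lin unfolding right_linear_op_def right_subspace_def pow_dom.simps funpow.simps o_apply
    by (auto simp: right_linear_op_pow_zero)
qed

end

lemma pow_dom_add_iff:
  "x \<in> pow_dom D T (i + j) \<longleftrightarrow> x \<in> pow_dom D T j \<and> (T ^^ j) x \<in> pow_dom D T i"
  by (induction i) (auto simp: funpow_add)

lemma pow_dom_le: "x \<in> pow_dom D T j \<Longrightarrow> i \<le> j \<Longrightarrow> x \<in> pow_dom D T i"
  by (metis pow_dom_add_iff le_add_diff_inverse2)

text \<open>Sequential form of closedness: \<open>u\<close> is Cauchy in the graph norm, hence has a
  limit \<open>z\<close> in \<open>D\<close> there, and uniqueness of limits in the norm identifies
  \<open>z\<close> with \<open>x\<close> and \<open>T z\<close> with \<open>y\<close>.\<close>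

lemma closed_op_limit:
  assumes lin: "right_linear_op D T" and "closed_op D T"
    and u: "\<And>j. u j \<in> D" and ux: "u \<longlonglongrightarrow> x" and Tuy: "(\<lambda>j. T (u j)) \<longlonglongrightarrow> y"
  shows "x \<in> D" and "T x = y"
proof -
  have "\<exists>J. \<forall>i\<ge>J. \<forall>j\<ge>J. norm (u i - u j) + norm (T (u i - u j)) < e" if "0 < e" for e
  proof -
    have "Cauchy u" "Cauchy (\<lambda>j. T (u j))"
      using ux Tuy by (auto intro: LIMSEQ_imp_Cauchy)
    then obtain J1 J2 where
      J1: "\<And>i j. i \<ge> J1 \<Longrightarrow> j \<ge> J1 \<Longrightarrow> norm (u i - u j) < e / 2" and
      J2: "\<And>i j. i \<ge> J2 \<Longrightarrow> j \<ge> J2 \<Longrightarrow> norm (T (u i) - T (u j)) < e / 2"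
      using \<open>0 < e\<close> unfolding Cauchy_iff by (meson half_gt_zero)
    have "norm (u i - u j) + norm (T (u i - u j)) < e"
      if "i \<ge> max J1 J2" "j \<ge> max J1 J2" for i j
    proof -
      have "norm (u i - u j) < e / 2" "norm (T (u i) - T (u j)) < e / 2"
        using that J1 J2 by auto
      then show ?thesis
        unfolding right_linear_op_diff[OF lin u u] by linarith
    qed
    then show ?thesis
      by (intro exI[of _ "max J1 J2"]) simp
  qed
  then obtain z where "z \<in> D" and z: "(\<lambda>j. norm (u j - z) + norm (T (u j - z))) \<longlonglongrightarrow> 0"
    using \<open>closed_op D T\<close>[unfolded closed_op_def complete_wrt_def, THEN spec, of u] u by auto
  have "(\<lambda>j. u j - z) \<longlonglongrightarrow> 0"
    by (rule Lim_null_comparison[OF _ z]) simp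
  then have "x = z"
    using ux unfolding Lim_null[symmetric] by (metis LIMSEQ_unique)
  have "(\<lambda>j. T (u j) - T z) \<longlonglongrightarrow> 0"
    by (rule Lim_null_comparison[OF _ z])
      (simp add: right_linear_op_diff[OF lin u \<open>z \<in> D\<close>])
  then have "T z = y"
    using Tuy unfolding Lim_null[symmetric] by (metis LIMSEQ_unique)
  then show "x \<in> D" "T x = y"
    using \<open>x = z\<close> \<open>z \<in> D\<close> by simp_all
qed

section \<open>Approximate inverses\<close>

text \<open>\<open>R\<close> inverts \<open>T\<close> up to the error \<open>P\<close>, which is
  smoothing: it gains one power of \<open>T\<close> at the price of a factor \<open>r\<close>. One
  \<open>c\<close> serves all three bounds, so that the dependence on the scale \<open>r\<close>
  stays explicit.\<close>

locale parametrix =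
  fixes D :: "'a::right_quat_banach set" and T :: "'a \<Rightarrow> 'a"
    and c r :: real and R P :: "'a \<Rightarrow> 'a"
  assumes lin: "right_linear_op D T"
    and c_nonneg: "0 \<le> c" and r_pos: "0 < r"
    and R_dom: "R x \<in> D" and P_dom: "P x \<in> D"
    and T_R: "T (R x) = x - P x"
    and R_T: "x \<in> D \<Longrightarrow> R (T x) = x - P x"
    and norm_R: "norm (R x) \<le> c / r * norm x"
    and norm_P: "norm (P x) \<le> c * norm x"
    and norm_TP: "norm (T (P x)) \<le> c * r * norm x"
begin

section \<open>Commutation of \<open>T\<close> with \<open>P\<close>, and estimates for powers of
  \<open>P\<close>\<close>

lemmas pow_subspace = right_linear_op_subspace[OF right_linear_op_pow[OF lin]]
lemmas pow_diff = right_linear_op_diff[OF right_linear_op_pow[OF lin]]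
lemmas pow_add = right_linear_op_add[OF right_linear_op_pow[OF lin]]

text \<open>Both sides come from evaluating \<open>T (R (T x))\<close> in two ways, by
  \<open>T_R\<close> and by \<open>R_T\<close>.\<close>

lemma T_P_commute:
  assumes "x \<in> D"
  shows "T (P x) = P (T x)"
proof -
  have "T x - P (T x) = T (x - P x)"
    using T_R[of "T x"] R_T[OF assms] by simp
  then show ?thesis
    using right_linear_op_diff[OF lin assms P_dom] by simp
qed

lemma pow_P: "x \<in> pow_dom D T i \<Longrightarrow> P x \<in> pow_dom D T (Suc i) \<and> (T ^^ i) (P x) = P ((T ^^ i) x)"
  by (induction i) (auto simp: P_dom T_P_commute)

lemma norm_pow_P: "x \<in> pow_dom D T i \<Longrightarrow> norm ((T ^^ i) (P x)) \<le> c * norm ((T ^^ i) x)"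
  using pow_P norm_P by simp

lemma norm_pow_Suc_P:
  "x \<in> pow_dom D T i \<Longrightarrow> norm ((T ^^ Suc i) (P x)) \<le> c * r * norm ((T ^^ i) x)"
  using pow_P norm_TP by simp

text \<open>As \<open>P\<close> commutes with powers of \<open>T\<close>, the left vector is
  \<open>R\<close> applied to \<open>(T ^^ Suc i) x\<close>: one power of \<open>T\<close> is traded
  for a factor \<open>1 / r\<close>.\<close>

lemma norm_pow_minus_P:
  assumes "x \<in> pow_dom D T (Suc i)"
  shows "norm ((T ^^ i) (x - P x)) \<le> c / r * norm ((T ^^ Suc i) x)"
proof -
  have "(T ^^ i) (x - P x) = R ((T ^^ Suc i) x)"
    using assms pow_P[of x i] by (simp add: pow_diff R_T)
  then show ?thesis using norm_R by simp
qed

text \<open>The factors \<open>P\<close> can be used either as bounded maps (cost \<open>c\<close>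
  each) or to absorb one \<open>T\<close> each (cost \<open>c * r\<close>).\<close>

lemma pow_P_pow:
  assumes "x \<in> pow_dom D T i"
  shows "(P ^^ j) x \<in> pow_dom D T (i + j)"
    and "norm ((T ^^ i) ((P ^^ j) x)) \<le> c ^ j * norm ((T ^^ i) x)"
    and "norm ((T ^^ (i + j)) ((P ^^ j) x)) \<le> (c * r) ^ j * norm ((T ^^ i) x)"
proof (induction j)
  case 0
  case 1 show ?case using assms by simp
  case 2 show ?case by simp
  case 3 show ?case by simp
next
  case (Suc j)
  case 1 show ?case using pow_P[OF Suc(1)] P_dom by simp
  have "(P ^^ j) x \<in> pow_dom D T i"
    using Suc(1) by (rule pow_dom_le) simp
  then have "norm ((T ^^ i) ((P ^^ Suc j) x)) \<le> c * norm ((T ^^ i) ((P ^^ j) x))"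
    using norm_pow_P by simp
  also have "\<dots> \<le> c * (c ^ j * norm ((T ^^ i) x))"
    using Suc(2) c_nonneg by (rule mult_left_mono)
  finally show "norm ((T ^^ i) ((P ^^ Suc j) x)) \<le> c ^ Suc j * norm ((T ^^ i) x)"
    by (simp add: mult.assoc)
  have "norm ((T ^^ (i + Suc j)) ((P ^^ Suc j) x)) \<le> c * r * norm ((T ^^ (i + j)) ((P ^^ j) x))"
    using norm_pow_Suc_P[OF Suc(1)] by simp
  also have "\<dots> \<le> c * r * ((c * r) ^ j * norm ((T ^^ i) x))"
    using Suc(3) c_nonneg r_pos by (intro mult_left_mono) auto
  finally show "norm ((T ^^ (i + Suc j)) ((P ^^ Suc j) x)) \<le> (c * r) ^ Suc j * norm ((T ^^ i) x)"
    by (simp add: mult.assoc)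
qed

lemma norm_pow_minus_P_pow:
  assumes "x \<in> pow_dom D T (Suc i)"
  shows "norm ((T ^^ i) (x - (P ^^ j) x)) \<le> (\<Sum>a<j. c ^ a) * c / r * norm ((T ^^ Suc i) x)"
proof (induction j)
  case 0
  then show ?case by (simp add: right_linear_op_pow_zero[OF lin])
next
  case (Suc j)
  let ?y = "(P ^^ j) x"
  have y: "?y \<in> pow_dom D T (Suc i)" "?y \<in> pow_dom D T i" "P ?y \<in> pow_dom D T i" and x: "x \<in> pow_dom D T i"
    using pow_dom_le[OF pow_P_pow(1)[OF assms, of j]] pow_dom_le[OF pow_P_pow(1)[OF assms, of "Suc j"]]
      pow_dom_le[OF assms] by (simp_all del: pow_dom.simps)
  \<comment> \<open>Telescoping: each increment is \<open>I - P\<close> applied to a power of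
    \<open>P\<close>, which yields the geometric sum.\<close>
  have "x - (P ^^ Suc j) x = (x - ?y) + (?y - P ?y)" by simp
  then have "(T ^^ i) (x - (P ^^ Suc j) x) = (T ^^ i) (x - ?y) + (T ^^ i) (?y - P ?y)"
    using x y by (metis pow_add pow_subspace subspace_diff)
  then have "norm ((T ^^ i) (x - (P ^^ Suc j) x))
      \<le> norm ((T ^^ i) (x - ?y)) + norm ((T ^^ i) (?y - P ?y))"
    by (simp add: norm_triangle_ineq)
  also have "norm ((T ^^ i) (?y - P ?y)) \<le> c / r * norm ((T ^^ Suc i) ?y)"
    using y(1) by (rule norm_pow_minus_P)
  also have "\<dots> \<le> c / r * (c ^ j * norm ((T ^^ Suc i) x))"
    using pow_P_pow(2)[OF assms] c_nonneg r_pos by (intro mult_left_mono) auto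
  finally show ?case using Suc.IH by (simp add: algebra_simps add_divide_distrib)
qed

text \<open>The part \<open>w\<close> of the splitting: \<open>j\<close> counts the powers of
  \<open>T\<close> gained by \<open>x - w\<close>, and \<open>l\<close> the factors
  \<open>1 / r\<close> gained by \<open>w\<close>.\<close>

definition rem :: "nat \<Rightarrow> nat \<Rightarrow> 'a \<Rightarrow> 'a" where
  "rem j l = (\<lambda>x. x - (P ^^ j) x) ^^ l"

lemma rem_0 [simp]: "rem j 0 x = x"
  by (simp add: rem_def)

lemma rem_Suc [simp]: "rem j (Suc l) x = rem j l x - (P ^^ j) (rem j l x)"
  by (simp add: rem_def)

lemma rem_bound:
  assumes "x \<in> pow_dom D T i"
  shows rem_dom: "rem j l x \<in> pow_dom D T i"
    and "norm ((T ^^ i) (rem j l x)) \<le> (1 + c ^ j) ^ l * norm ((T ^^ i) x)"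
proof (induction l)
  case 0
  case 1 show ?case using assms by simp
  case 2 show ?case by simp
next
  case (Suc l)
  let ?y = "rem j l x"
  have Py: "(P ^^ j) ?y \<in> pow_dom D T i"
    using pow_P_pow(1)[OF Suc(1), of j] by (rule pow_dom_le) simp
  case 1 show ?case
    using Suc(1) Py by (simp add: subspace_diff pow_subspace)
  have "norm ((T ^^ i) (rem j (Suc l) x)) \<le> norm ((T ^^ i) ?y) + norm ((T ^^ i) ((P ^^ j) ?y))"
    using Suc(1) Py by (simp add: pow_diff norm_triangle_ineq4)
  also have "\<dots> \<le> (1 + c ^ j) * norm ((T ^^ i) ?y)"
    using pow_P_pow(2)[OF Suc(1), of j] by (simp add: algebra_simps)
  also have "\<dots> \<le> (1 + c ^ j) * ((1 + c ^ j) ^ l * norm ((T ^^ i) x))"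
    using Suc(2) c_nonneg by (intro mult_left_mono) auto
  finally show "norm ((T ^^ i) (rem j (Suc l) x)) \<le> (1 + c ^ j) ^ Suc l * norm ((T ^^ i) x)"
    by (simp add: mult.assoc)
qed

text \<open>Each of the \<open>l\<close> factors \<open>I - P^j\<close> trades one power of
  \<open>T\<close> for \<open>1 / r\<close>. The induction varies \<open>i\<close>, since removing a
  factor leads to the power \<open>Suc i\<close>.\<close>

lemma rem_decay:
  "x \<in> pow_dom D T (i + l) \<Longrightarrow>
    norm ((T ^^ i) (rem j l x)) \<le> ((\<Sum>a<j. c ^ a) * c / r) ^ l * norm ((T ^^ (i + l)) x)"
proof (induction l arbitrary: i)
  case 0
  then show ?case by simp
next
  case (Suc l)
  let ?C = "(\<Sum>a<j. c ^ a) * c / r"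
  have "0 \<le> ?C" using c_nonneg r_pos by (simp add: sum_nonneg)
  have "rem j l x \<in> pow_dom D T (Suc i)"
    by (intro rem_dom pow_dom_le[OF Suc.prems]) simp
  then have "norm ((T ^^ i) (rem j (Suc l) x)) \<le> ?C * norm ((T ^^ Suc i) (rem j l x))"
    unfolding rem_Suc by (rule norm_pow_minus_P_pow)
  also have "\<dots> \<le> ?C * (?C ^ l * norm ((T ^^ (Suc i + l)) x))"
    using Suc.prems by (intro mult_left_mono Suc.IH \<open>0 \<le> ?C\<close>) simp
  finally show ?case by (simp add: mult.assoc)
qed

text \<open>Telescoping in \<open>l\<close> writes the difference as the sum of
  \<open>(P ^^ j) (rem j a x)\<close> over \<open>a < l\<close>; every summand is in the range of
  \<open>P ^^ j\<close> and so gains \<open>j\<close> powers.\<close>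

lemma minus_rem_smooth:
  assumes "x \<in> pow_dom D T i"
  shows minus_rem_dom: "x - rem j l x \<in> pow_dom D T (i + j)"
    and "norm ((T ^^ (i + j)) (x - rem j l x))
      \<le> (\<Sum>a<l. (1 + c ^ j) ^ a) * (c * r) ^ j * norm ((T ^^ i) x)"
proof (induction l)
  case 0
  case 1 show ?case by (simp add: subspace_0 pow_subspace)
  case 2 show ?case by (simp add: right_linear_op_pow_zero[OF lin])
next
  case (Suc l)
  let ?y = "rem j l x"
  have y: "?y \<in> pow_dom D T i" using assms by (rule rem_dom)
  have Py: "(P ^^ j) ?y \<in> pow_dom D T (i + j)"
    using pow_P_pow(1)[OF y] .
  have eq: "x - rem j (Suc l) x = (x - ?y) + (P ^^ j) ?y" by simp
  case 1 show ?case
    unfolding eq using Suc(1) Py by (rule subspace_add[OF pow_subspace])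
  have "norm ((T ^^ (i + j)) (x - rem j (Suc l) x))
      \<le> norm ((T ^^ (i + j)) (x - ?y)) + norm ((T ^^ (i + j)) ((P ^^ j) ?y))"
    unfolding eq pow_add[OF Suc(1) Py] by (rule norm_triangle_ineq)
  also have "norm ((T ^^ (i + j)) ((P ^^ j) ?y)) \<le> (c * r) ^ j * norm ((T ^^ i) ?y)"
    using y by (rule pow_P_pow)
  also have "\<dots> \<le> (c * r) ^ j * ((1 + c ^ j) ^ l * norm ((T ^^ i) x))"
    using rem_bound(2)[OF assms] c_nonneg r_pos by (intro mult_left_mono) auto
  finally show "norm ((T ^^ (i + j)) (x - rem j (Suc l) x))
      \<le> (\<Sum>a<Suc l. (1 + c ^ j) ^ a) * (c * r) ^ j * norm ((T ^^ i) x)"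
    using Suc(2) by (simp add: algebra_simps)
qed

text \<open>Split with \<open>j = i\<close> and \<open>l = k - i\<close>: the smooth part gains
  \<open>i\<close> powers starting from \<open>norm x\<close>, and the remainder is controlled by
  the top power \<open>k\<close>.\<close>

lemma intermediate_pow_bound:
  assumes "i \<le> k"
  shows "\<exists>C\<ge>0. \<forall>x\<in>pow_dom D T k. norm ((T ^^ i) x) \<le> C * (norm x + norm ((T ^^ k) x))"
proof -
  define l where "l = k - i"
  define C1 where "C1 = (\<Sum>a<l. (1 + c ^ i) ^ a) * (c * r) ^ i"
  define C2 where "C2 = ((\<Sum>a<i. c ^ a) * c / r) ^ l"
  have nonneg: "0 \<le> C1" "0 \<le> C2"
    unfolding C1_def C2_def using c_nonneg r_pos by (auto simp: sum_nonneg)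
  have "norm ((T ^^ i) x) \<le> (C1 + C2) * (norm x + norm ((T ^^ k) x))" if x: "x \<in> pow_dom D T k" for x
  proof -
    let ?y = "rem i l x"
    have k: "k = i + l" using assms by (simp add: l_def)
    have y: "?y \<in> pow_dom D T i" "x - ?y \<in> pow_dom D T i"
      using rem_dom[OF pow_dom_le[OF x assms]] minus_rem_dom[of x 0 i l] by auto
    have "(T ^^ i) x = (T ^^ i) (x - ?y) + (T ^^ i) ?y"
      using pow_add[OF y(2,1)] by simp
    then have "norm ((T ^^ i) x) \<le> norm ((T ^^ i) (x - ?y)) + norm ((T ^^ i) ?y)"
      by (simp add: norm_triangle_ineq)
    also have "norm ((T ^^ i) (x - ?y)) \<le> C1 * norm x"
      using minus_rem_smooth(2)[of x 0 i l] by (simp add: C1_def)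
    also have "norm ((T ^^ i) ?y) \<le> C2 * norm ((T ^^ k) x)"
      using rem_decay x by (simp add: C2_def k)
    also have "C1 * norm x + C2 * norm ((T ^^ k) x) \<le> (C1 + C2) * (norm x + norm ((T ^^ k) x))"
      using nonneg by (simp add: algebra_simps)
    finally show ?thesis by simp
  qed
  then show ?thesis using nonneg by (intro exI[of _ "C1 + C2"]) auto
qed

end

section \<open>The spaces \<open>D(T\<^sup>k)\<close>\<close>

lemma pow_space_sel [simp]:
  "pts (pow_space D T i) = pow_dom D T i"
  "nrm (pow_space D T i) x = norm x + norm ((T ^^ i) x)"
  by (simp_all add: pow_space_def)

text \<open>Only completeness needs work: by the intermediate bound, a Cauchy sequence has all its
  images under \<open>T ^^ i\<close>, \<open>i \<le> k\<close>, convergent, and closedness of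
  \<open>T\<close> then applies one power at a time.\<close>

lemma (in parametrix) right_banach_pow_space:
  assumes closed: "closed_op D T"
  shows "right_banach (pow_space D T k)"
proof -
  have "\<exists>x\<in>pow_dom D T k. (\<lambda>j. norm (u j - x) + norm ((T ^^ k) (u j - x))) \<longlonglongrightarrow> 0"
    if u: "\<And>j. u j \<in> pow_dom D T k"
      and Cauchy: "\<And>e. 0 < e \<Longrightarrow> \<exists>J. \<forall>i\<ge>J. \<forall>j\<ge>J. norm (u i - u j) + norm ((T ^^ k) (u i - u j)) < e"
    for u
  proof -
    have ui: "u j \<in> pow_dom D T i" if "i \<le> k" for i j
      using u that by (rule pow_dom_le)
    have "convergent (\<lambda>j. (T ^^ i) (u j))" if "i \<le> k" for i
    proof -
      obtain C where "0 \<le> C"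
        and C: "\<And>x. x \<in> pow_dom D T k \<Longrightarrow> norm ((T ^^ i) x) \<le> C * (norm x + norm ((T ^^ k) x))"
        using intermediate_pow_bound[OF \<open>i \<le> k\<close>] by blast
      have "Cauchy (\<lambda>j. (T ^^ i) (u j))"
        unfolding Cauchy_iff
      proof (intro allI impI)
        fix e :: real
        assume "0 < e"
        \<comment> \<open>\<open>C + 1\<close> rather than \<open>C\<close>, which may be 0.\<close>
        then obtain J where J: "\<And>a b. a \<ge> J \<Longrightarrow> b \<ge> J \<Longrightarrow>
            norm (u a - u b) + norm ((T ^^ k) (u a - u b)) < e / (C + 1)"
          using Cauchy[of "e / (C + 1)"] \<open>0 \<le> C\<close> by auto
        have "norm ((T ^^ i) (u a) - (T ^^ i) (u b)) < e" if "a \<ge> J" "b \<ge> J" for a b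
        proof -
          let ?N = "norm (u a - u b) + norm ((T ^^ k) (u a - u b))"
          have "norm ((T ^^ i) (u a) - (T ^^ i) (u b)) = norm ((T ^^ i) (u a - u b))"
            using pow_diff[OF ui ui] \<open>i \<le> k\<close> by simp
          also have "\<dots> \<le> C * ?N"
            using u by (intro C subspace_diff[OF pow_subspace])
          also have "\<dots> \<le> (C + 1) * ?N"
            by (intro mult_right_mono) simp_all
          also have "\<dots> < e"
            using J[OF that] \<open>0 \<le> C\<close> by (simp add: field_simps)
          finally show ?thesis .
        qed
        then show "\<exists>J. \<forall>a\<ge>J. \<forall>b\<ge>J. norm ((T ^^ i) (u a) - (T ^^ i) (u b)) < e"
          by blast
      qed
      then show ?thesis by (rule Cauchy_convergent)
    qed
    then obtain L where L: "\<And>i. i \<le> k \<Longrightarrow> (\<lambda>j. (T ^^ i) (u j)) \<longlonglongrightarrow> L i"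
      unfolding convergent_def by metis
    \<comment> \<open>\<open>L 0\<close> is the limit of \<open>u\<close> itself; climbing through
      the powers places it in the domain of \<open>T ^^ k\<close>.\<close>
    have lim: "i \<le> k \<Longrightarrow> L 0 \<in> pow_dom D T i \<and> (T ^^ i) (L 0) = L i" for i
    proof (induction i)
      case 0
      then show ?case by simp
    next
      case (Suc i)
      have "\<And>j. (T ^^ i) (u j) \<in> D" and "(\<lambda>j. T ((T ^^ i) (u j))) \<longlonglongrightarrow> L (Suc i)"
        using ui[OF Suc.prems] L[OF Suc.prems] by simp_all
      with closed_op_limit[OF lin closed _ L[of i]] Suc
      show ?case by simp
    qed
    have L0: "L 0 \<in> pow_dom D T k" "(T ^^ k) (L 0) = L k"
      using lim[of k] by simp_all
    have "(\<lambda>j. norm (u j - L 0) + norm ((T ^^ k) (u j) - L k)) \<longlonglongrightarrow> 0 + 0"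
      using L[of 0] L[of k] by (intro tendsto_add) (simp_all add: tendsto_norm_zero LIM_zero)
    then show ?thesis
      using L0 by (intro bexI[of _ "L 0"]) (simp_all add: pow_diff[OF u L0(1)])
  qed
  then have "complete_wrt (pow_dom D T k) (\<lambda>x. norm x + norm ((T ^^ k) x))"
    unfolding complete_wrt_def by blast
  moreover have "norm (x + y) + norm ((T ^^ k) (x + y))
      \<le> (norm x + norm ((T ^^ k) x)) + (norm y + norm ((T ^^ k) y))"
    if "x \<in> pow_dom D T k" "y \<in> pow_dom D T k" for x y
    using pow_add[OF that] norm_triangle_ineq[of x y] norm_triangle_ineq[of "(T ^^ k) x" "(T ^^ k) y"]
    by simp
  moreover have "norm (x *\<^sub>Q s) + norm ((T ^^ k) (x *\<^sub>Q s)) = (norm x + norm ((T ^^ k) x)) * norm s"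
    if "x \<in> pow_dom D T k" for x s
    using right_linear_op_scaleQ[OF right_linear_op_pow[OF lin] that]
    by (simp add: norm_scaleQ distrib_right)
  moreover have "norm x + norm ((T ^^ k) x) = 0 \<longleftrightarrow> x = 0" for x
    using right_linear_op_pow_zero[OF lin] by (auto simp: add_nonneg_eq_0_iff)
  moreover have "right_subspace (pow_dom D T k)"
    using right_linear_op_pow[OF lin] by (simp add: right_linear_op_def)
  ultimately show ?thesis
    by (simp add: right_banach_def pow_space_def)
qed

section \<open>Continuous embeddings: into the ambient space, into sums, from intersections\<close>

lemma cont_in_ambient_pow_space:
  fixes D :: "'a::right_quat_banach set"
  shows "cont_in_ambient (pow_space D T k)"
  unfolding cont_in_ambient_def pow_space_sel
proof (intro ballI allI impI)
  fix y :: 'a and U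
  assume "open U \<and> y \<in> U"
  then obtain e where "0 < e" and e: "ball y e \<subseteq> U"
    using open_contains_ball by blast
  have "z \<in> U" if "norm (z - y) + norm ((T ^^ k) (z - y)) < e" for z
  proof -
    have "norm (z - y) < e"
      using that norm_ge_zero[of "(T ^^ k) (z - y)"] by linarith
    then show ?thesis
      using e by (auto simp: dist_norm norm_minus_commute)
  qed
  then show "\<exists>e>0. \<forall>z\<in>pow_dom D T k. norm (z - y) + norm ((T ^^ k) (z - y)) < e \<longrightarrow> z \<in> U"
    using \<open>0 < e\<close> by blast
qed

text \<open>Nonnegativity bounds the set of competitors below, so that its real \<open>Inf\<close>
  is a genuine infimum.\<close>

lemma K_functional_le:
  assumes "\<And>a. a \<in> pts Y0 \<Longrightarrow> 0 \<le> nrm Y0 a" "\<And>b. b \<in> pts Y1 \<Longrightarrow> 0 \<le> nrm Y1 b"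
    and "0 \<le> t" "a \<in> pts Y0" "b \<in> pts Y1" "x = a + b"
  shows "K_functional Y0 Y1 t x \<le> nrm Y0 a + t * nrm Y1 b"
  unfolding K_functional_def
  by (intro cInf_lower bdd_belowI[of _ 0]) (use assms in auto)

lemma cont_embedded_sum_space:
  assumes "E \<hookrightarrow> Y0" "0 \<in> pts Y1" "nrm Y1 0 = 0"
    and "\<And>a. a \<in> pts Y0 \<Longrightarrow> 0 \<le> nrm Y0 a" "\<And>b. b \<in> pts Y1 \<Longrightarrow> 0 \<le> nrm Y1 b"
  shows "E \<hookrightarrow> sum_space Y0 Y1"
proof -
  obtain C where "0 \<le> C" and sub: "pts E \<subseteq> pts Y0" and C: "\<And>x. x \<in> pts E \<Longrightarrow> nrm Y0 x \<le> C * nrm E x"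
    using assms(1) by (auto simp: cont_embedded_def)
  have "nrm (sum_space Y0 Y1) x \<le> C * nrm E x" if "x \<in> pts E" for x
  proof -
    \<comment> \<open>The sum norm is the \<open>K\<close>-functional at \<open>t = 1\<close>,
      tested with the splitting \<open>x = x + 0\<close>.\<close>
    have "nrm (sum_space Y0 Y1) x = K_functional Y0 Y1 1 x"
      by (simp add: sum_space_def K_functional_def)
    also have "\<dots> \<le> nrm Y0 x + 1 * nrm Y1 0"
      using assms sub that by (intro K_functional_le) auto
    finally show ?thesis
      using C[OF that] assms by simp
  qed
  moreover have "pts E \<subseteq> pts (sum_space Y0 Y1)"
    using sub assms(2) by (force simp: sum_space_def)
  ultimately show ?thesis
    using \<open>0 \<le> C\<close> by (auto simp: cont_embedded_def)
qed

lemma (in parametrix) cont_embedded_pow_space: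
  assumes "i \<le> k"
  shows "pow_space D T k \<hookrightarrow> pow_space D T i"
proof -
  obtain C where "0 \<le> C"
    and C: "\<And>x. x \<in> pow_dom D T k \<Longrightarrow> norm ((T ^^ i) x) \<le> C * (norm x + norm ((T ^^ k) x))"
    using intermediate_pow_bound[OF assms] by blast
  have "norm x + norm ((T ^^ i) x) \<le> (1 + C) * (norm x + norm ((T ^^ k) x))" if "x \<in> pow_dom D T k" for x
    using C[OF that] norm_ge_zero[of "(T ^^ k) x"] unfolding distrib_left distrib_right mult_1
    by linarith
  then show ?thesis
    unfolding cont_embedded_def pow_space_sel
    using \<open>0 \<le> C\<close> pow_dom_le[OF _ assms] by (intro conjI exI[of _ "1 + C"]) auto
qed

lemma cont_embedded_inter_space:
  assumes "Y1 \<hookrightarrow> E"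
  shows "inter_space Y0 Y1 \<hookrightarrow> E"
proof -
  obtain C where "0 \<le> C" and "pts Y1 \<subseteq> pts E" and C: "\<And>x. x \<in> pts Y1 \<Longrightarrow> nrm E x \<le> C * nrm Y1 x"
    using assms by (auto simp: cont_embedded_def)
  moreover have "nrm E x \<le> C * max (nrm Y0 x) (nrm Y1 x)" if "x \<in> pts Y1" for x
    by (rule order_trans[OF C[OF that]]) (intro mult_left_mono max.cobounded2 \<open>0 \<le> C\<close>)
  ultimately show ?thesis
    by (auto simp: cont_embedded_def inter_space_def)
qed

section \<open>Approximate inverses from the \<open>S\<close>-resolvent\<close>

lemma parametrix_of_S_resolvent:
  assumes lin: "right_linear_op D T" and closed: "closed_op D T"
    and s: "s \<in> S_resolvent_set D T" and "s \<noteq> 0" and "0 \<le> M"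
    and norm_Q: "onorm (Q_inv D T s) \<le> M / (norm s)\<^sup>2"
    and norm_TQ: "onorm (T \<circ> Q_inv D T s) \<le> M / norm s"
  shows "\<exists>R P. parametrix D T (7 * M + 2) (norm s) R P"
proof -
  define A where "A = Q_inv D T s"
  define r where "r = norm s"
  define p where "p = 2 * qre s"
  define P where "P x = r\<^sup>2 *\<^sub>R A x - p *\<^sub>R T (A x)" for x
  have "0 < r" using \<open>s \<noteq> 0\<close> by (simp add: r_def)
  have "\<bar>qre s\<bar> \<le> r"
    unfolding r_def norm_quat_def by (rule real_le_rsqrt) simp
  then have p: "\<bar>p\<bar> \<le> 2 * r" by (simp add: p_def)
  have Q: "Q_op T s y = T (T y) - p *\<^sub>R T y + r\<^sup>2 *\<^sub>R y" for y
    by (simp only: Q_op_def scaleQ_of_real p_def r_def) (simp add: numeral_2_eq_2)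
  have dom2: "y \<in> pow_dom D T 2 \<longleftrightarrow> y \<in> D \<and> T y \<in> D" for y
    by (simp add: numeral_2_eq_2)
  note sub = right_linear_op_subspace[OF lin]
  have bij: "bij_betw (Q_op T s) (pow_dom D T 2) UNIV" and bdd: "bounded_right_linear A"
    using s by (simp_all add: S_resolvent_set_def A_def)
  have A_dom2: "A x \<in> pow_dom D T 2" for x
    unfolding A_def Q_inv_def by (rule inv_into_into) (use bij in \<open>auto simp: bij_betw_def\<close>)
  then have A_dom: "A x \<in> D" "T (A x) \<in> D" for x
    by (simp_all add: dom2)
  have Q_A: "Q_op T s (A x) = x" for x
    unfolding A_def Q_inv_def by (rule f_inv_into_f) (use bij in \<open>auto simp: bij_betw_def\<close>)
  have A_Q: "A (Q_op T s y) = y" if "y \<in> D" "T y \<in> D" for y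
    unfolding A_def Q_inv_def using that bij
    by (intro inv_into_f_f) (auto simp: bij_betw_def dom2)
  have linA: "right_linear_op UNIV A"
    using bdd by (simp add: bounded_right_linear_def)
  have "linear A"
    by (rule linearI)
      (simp_all add: right_linear_op_add[OF linA] right_linear_op_scaleR[OF linA])
  obtain C where "\<And>x. norm (A x) \<le> C * norm x"
    using bdd by (auto simp: bounded_right_linear_def)
  with \<open>linear A\<close> have "bounded_linear A"
    by (intro bounded_linear.intro bounded_linear_axioms.intro) (auto simp: mult.commute)
  \<comment> \<open>This is what lets the hypothesis on \<open>onorm\<close> yield the pointwise
    bound \<open>norm_TA\<close>.\<close>
  have "bounded_linear (T \<circ> A)"
  proof (rule closed_graph_bounded_linear)
    show "linear (T \<circ> A)"
      by (rule linearI) (simp_all add: right_linear_op_add[OF linA] right_linear_op_scaleR[OF linA]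
          right_linear_op_add[OF lin] right_linear_op_scaleR[OF lin] A_dom)
    show "(T \<circ> A) x = y" if "u \<longlonglongrightarrow> x" "(\<lambda>i. (T \<circ> A) (u i)) \<longlonglongrightarrow> y" for u x y
    proof -
      have "(\<lambda>i. A (u i)) \<longlonglongrightarrow> A x"
        using \<open>bounded_linear A\<close> that(1) by (rule bounded_linear.tendsto)
      with that(2) closed_op_limit(2)[OF lin closed, of "\<lambda>i. A (u i)"] show ?thesis
        by (simp add: A_dom)
    qed
  qed
  have norm_A: "norm (A x) \<le> M / r\<^sup>2 * norm x" for x
    using onorm[OF \<open>bounded_linear A\<close>, of x] norm_Q mult_right_mono[of "onorm A" "M / r\<^sup>2" "norm x"]
    by (simp add: A_def r_def)
  have norm_TA: "norm (T (A x)) \<le> M / r * norm x" for x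
    using onorm[OF \<open>bounded_linear (T \<circ> A)\<close>, of x] norm_TQ
      mult_right_mono[of "onorm (T \<circ> A)" "M / r" "norm x"]
    by (simp add: A_def r_def)
  \<comment> \<open>The equation \<open>Q_op T s (A x) = x\<close> solved for the second-order
    term.\<close>
  have TTA: "T (T (A x)) = x - P x" for x
    using Q_A[of x] unfolding Q P_def by (simp add: algebra_simps)
  have P_dom: "P x \<in> D" for x
    unfolding P_def by (intro subspace_diff[OF sub] subspace_scale[OF sub] A_dom)
  \<comment> \<open>\<open>T\<close> commutes with the polynomial \<open>Q_op T s\<close>; for
    \<open>x\<close> in \<open>D\<close>, \<open>TTA\<close> puts \<open>A x\<close> in the domain
    of the third power, and injectivity of \<open>Q_op T s\<close> then moves \<open>A\<close> past
    \<open>T\<close>.\<close>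
  have TA: "T (A x) = A (T x)" if "x \<in> D" for x
  proof -
    let ?y = "A x"
    have TTy: "T (T ?y) \<in> D"
      unfolding TTA by (intro subspace_diff[OF sub] that P_dom)
    have "T x = T (T (T ?y) - p *\<^sub>R T ?y + r\<^sup>2 *\<^sub>R ?y)"
      using Q_A[of x] by (simp add: Q)
    also have "\<dots> = T (T (T ?y)) - p *\<^sub>R T (T ?y) + r\<^sup>2 *\<^sub>R T ?y"
      using TTy A_dom by (simp add: right_linear_op_add[OF lin] right_linear_op_diff[OF lin]
          right_linear_op_scaleR[OF lin] subspace_diff[OF sub] subspace_scale[OF sub])
    also have "\<dots> = Q_op T s (T ?y)"
      by (simp add: Q)
    finally show ?thesis
      using A_Q[of "T ?y"] A_dom TTy by simp
  qed
  have norm_P: "norm (P x) \<le> 3 * M * norm x" for x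
  proof -
    have "norm (P x) \<le> norm (r\<^sup>2 *\<^sub>R A x) + norm (p *\<^sub>R T (A x))"
      unfolding P_def by (rule norm_triangle_ineq4)
    also have "\<dots> = r\<^sup>2 * norm (A x) + \<bar>p\<bar> * norm (T (A x))" by simp
    also have "\<dots> \<le> r\<^sup>2 * (M / r\<^sup>2 * norm x) + 2 * r * (M / r * norm x)"
      using p \<open>0 < r\<close> by (intro add_mono mult_mono norm_A norm_TA) auto
    also have "\<dots> = 3 * M * norm x"
      using \<open>0 < r\<close> by (simp add: field_simps)
    finally show ?thesis .
  qed
  have norm_TP: "norm (T (P x)) \<le> (7 * M + 2) * r * norm x" for x
  proof -
    \<comment> \<open>Replacing \<open>T (T (A x))\<close> by \<open>x - P x\<close> leaves only
      bounded terms: \<open>M\<close> from the first and \<open>2 * (1 + 3 * M)\<close> from the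
      second add up to \<open>7 * M + 2\<close>, which also dominates the constants \<open>M\<close>
      and \<open>3 * M\<close> of the other bounds.\<close>
    have "T (P x) = r\<^sup>2 *\<^sub>R T (A x) - p *\<^sub>R (x - P x)"
      unfolding TTA[symmetric]
      by (simp add: P_def A_dom right_linear_op_diff[OF lin] right_linear_op_scaleR[OF lin]
          subspace_scale[OF sub])
    then have "norm (T (P x)) \<le> norm (r\<^sup>2 *\<^sub>R T (A x)) + norm (p *\<^sub>R (x - P x))"
      by (metis norm_triangle_ineq4)
    also have "\<dots> = r\<^sup>2 * norm (T (A x)) + \<bar>p\<bar> * norm (x - P x)" by simp
    also have "\<dots> \<le> r\<^sup>2 * (M / r * norm x) + 2 * r * (norm x + 3 * M * norm x)"
      using p \<open>0 < r\<close> norm_P[of x] norm_triangle_ineq4[of x "P x"]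
      by (intro add_mono mult_mono norm_TA) auto
    also have "\<dots> = (7 * M + 2) * r * norm x"
      using \<open>0 < r\<close> by (simp add: field_simps power2_eq_square)
    finally show ?thesis .
  qed
  have "parametrix D T (7 * M + 2) r (T \<circ> A) P"
  proof
    fix x
    show "(T \<circ> A) (T x) = x - P x" if "x \<in> D"
      using TA[OF that] TTA[of x] by simp
    have "M / r * norm x \<le> (7 * M + 2) / r * norm x"
      using \<open>0 \<le> M\<close> \<open>0 < r\<close> by (intro mult_right_mono divide_right_mono) auto
    then show "norm ((T \<circ> A) x) \<le> (7 * M + 2) / r * norm x"
      using norm_TA[of x] by simp
    have "3 * M * norm x \<le> (7 * M + 2) * norm x"
      using \<open>0 \<le> M\<close> by (intro mult_right_mono) auto
    then show "norm (P x) \<le> (7 * M + 2) * norm x"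
      using norm_P[of x] by simp
  qed (use lin \<open>0 \<le> M\<close> \<open>0 < r\<close> A_dom P_dom TTA norm_TP in auto)
  then show ?thesis
    unfolding r_def by blast
qed

text \<open>Since \<open>quat_expi i \<omega>\<close> has modulus 1, the ray set meets every sphere
  around 0; hence approximate inverses exist at every scale \<open>r\<close>.\<close>

lemma quat_ray_set_norm:
  assumes "0 < r"
  shows "\<exists>s\<in>quat_ray_set \<omega>. norm s = r"
proof -
  define i where "i = Quat 0 1 0 0"
  have of_real: "of_real a = Quat a 0 0 0" for a
    by (simp add: of_real_def one_quat_def scaleR_quat_def)
  have "i \<in> imag_units"
    by (simp add: imag_units_def i_def norm_quat_def)
  moreover have "norm (quat_expi i \<omega>) = 1"
    by (simp add: quat_expi_def of_real norm_quat_def i_def)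
  ultimately show ?thesis
    using assms unfolding quat_ray_set_def
    by (intro bexI[of _ "of_real r * quat_expi i \<omega>"]) (auto simp: norm_mult)
qed

section \<open>The \<open>K\<close>-functional\<close>

text \<open>As \<open>c\<close> is common to all scales, \<open>r\<close> may be tuned to
  \<open>t\<close> while the constants stay free of \<open>t\<close>.\<close>

lemma K_functional_pow_space_bound:
  assumes lin: "right_linear_op D T" and "0 \<le> c"
    and param: "\<And>r. 0 < r \<Longrightarrow> \<exists>R P. parametrix D T c r R P"
    and "n < k" "k < m"
  defines "\<theta> \<equiv> (real k - real n) / (real m - real n)"
  shows "\<exists>C\<ge>0. \<forall>t>0. \<forall>x\<in>pow_dom D T k.
    K_functional (pow_space D T n) (pow_space D T m) t x \<le> C * t powr \<theta> * (norm x + norm ((T ^^ k) x))"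
proof -
  have \<theta>: "0 < \<theta>" "\<theta> < 1" using \<open>n < k\<close> \<open>k < m\<close> by (simp_all add: \<theta>_def)
  define l j where "l = k - n" and "j = m - k"
  have kl: "k = n + l" and mj: "m = k + j" using \<open>n < k\<close> \<open>k < m\<close> by (simp_all add: l_def j_def)
  \<comment> \<open>Intermediate powers are bounded at the fixed scale 1, so
    \<open>C\<^sub>n\<close> and \<open>C\<^sub>l\<close> do not depend on \<open>t\<close>.\<close>
  obtain R1 P1 where "parametrix D T c 1 R1 P1"
    using param zero_less_one by blast
  note bound = parametrix.intermediate_pow_bound[OF this]
  obtain C\<^sub>n where "0 \<le> C\<^sub>n"
    and C\<^sub>n: "\<And>x. x \<in> pow_dom D T k \<Longrightarrow> norm ((T ^^ n) x) \<le> C\<^sub>n * (norm x + norm ((T ^^ k) x))"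
    using bound[of n k] \<open>n < k\<close> by auto
  obtain C\<^sub>l where "0 \<le> C\<^sub>l"
    and C\<^sub>l: "\<And>x. x \<in> pow_dom D T k \<Longrightarrow> norm ((T ^^ l) x) \<le> C\<^sub>l * (norm x + norm ((T ^^ k) x))"
    using bound[of l k] l_def by auto
  \<comment> \<open>The factors, freed of \<open>r\<close>, in \<open>rem_decay\<close>
    (\<open>a1\<close>), in the plain bound for \<open>x - w\<close> (\<open>a2\<close>) and in
    \<open>minus_rem_smooth\<close> (\<open>a3\<close>).\<close>
  define a1 where "a1 = ((\<Sum>i<j. c ^ i) * c) ^ l"
  define a2 where "a2 = 1 + (1 + c ^ j) ^ l"
  define a3 where "a3 = (\<Sum>i<l. (1 + c ^ j) ^ i) * c ^ j"
  have nonneg: "0 \<le> a1" "0 \<le> a2" "0 \<le> a3"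
    using \<open>0 \<le> c\<close> by (auto simp: a1_def a2_def a3_def intro!: sum_nonneg mult_nonneg_nonneg zero_le_power)
  define C where "C = 1 + C\<^sub>n + (a1 * C\<^sub>l + a1 + a2 + a3)"
  have "0 \<le> C"
    using nonneg \<open>0 \<le> C\<^sub>l\<close> \<open>0 \<le> C\<^sub>n\<close> by (simp add: C_def)
  have "K_functional (pow_space D T n) (pow_space D T m) t x \<le> C * t powr \<theta> * (norm x + norm ((T ^^ k) x))"
    if "0 < t" and x: "x \<in> pow_dom D T k" for t x
  proof -
    let ?K = "K_functional (pow_space D T n) (pow_space D T m) t x"
    define N where "N = norm x + norm ((T ^^ k) x)"
    have N: "norm x \<le> N" "norm ((T ^^ k) x) \<le> N" "0 \<le> N" by (simp_all add: N_def)
    have K_le: "?K \<le> (norm a + norm ((T ^^ n) a)) + t * (norm b + norm ((T ^^ m) b))"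
      if "a \<in> pow_dom D T n" "b \<in> pow_dom D T m" "x = a + b" for a b
      using K_functional_le[of "pow_space D T n" "pow_space D T m" t a b x] that \<open>0 < t\<close> by simp
    show ?thesis
    proof (cases "1 \<le> t")
      case True
      have "?K \<le> norm x + norm ((T ^^ n) x)"
        using K_le[of x 0] pow_dom_le[OF x, of n] \<open>n < k\<close>
          subspace_0[OF right_linear_op_subspace[OF right_linear_op_pow[OF lin]]]
          right_linear_op_pow_zero[OF lin] by simp
      also have "\<dots> \<le> (1 + C\<^sub>n) * N"
        using C\<^sub>n[OF x, folded N_def] N by (simp add: distrib_right)
      also have "\<dots> \<le> C * N"
        using N nonneg \<open>0 \<le> C\<^sub>l\<close> by (intro mult_right_mono) (simp_all add: C_def)
      also have "\<dots> \<le> C * t powr \<theta> * N"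
        using ge_one_powr_ge_zero[OF True, of \<theta>] \<theta> N \<open>0 \<le> C\<close>
        by (intro mult_right_mono) (simp_all add: mult_le_cancel_left1)
      finally show ?thesis by (simp add: N_def)
    next
      case False
      \<comment> \<open>This scale balances the two estimates: the decay \<open>1 / r ^ l\<close>
        and the weighted growth \<open>t * r ^ j\<close> both become \<open>t powr \<theta>\<close>,
        because \<open>l + j = m - n\<close>.\<close>
      define r where "r = t powr (- 1 / (real m - real n))"
      have "0 < r" using \<open>0 < t\<close> by (simp add: r_def)
      have "r ^ l = t powr - \<theta>"
        using \<open>0 < t\<close> \<open>n < k\<close>
        by (simp add: r_def \<theta>_def l_def powr_power of_nat_diff)
      then have r_l: "1 / r ^ l = t powr \<theta>"
        by (simp add: powr_minus inverse_eq_divide)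
      have "r ^ j = t powr - ((real m - real k) / (real m - real n))"
        using \<open>0 < t\<close> \<open>k < m\<close> by (simp add: r_def j_def powr_power of_nat_diff)
      then have "t * r ^ j = t powr (1 + - ((real m - real k) / (real m - real n)))"
        using \<open>0 < t\<close> by (simp only: powr_add powr_one)
      also have "1 + - ((real m - real k) / (real m - real n)) = \<theta>"
        using \<open>n < k\<close> \<open>k < m\<close> by (simp add: \<theta>_def field_simps)
      finally have r_j: "t * r ^ j = t powr \<theta>" .
      \<comment> \<open>Here \<open>t < 1\<close> matters: it absorbs the lower-order term
        \<open>t * norm (x - w)\<close>.\<close>
      have t_le: "t \<le> t powr \<theta>"
        using powr_mono'[of \<theta> 1 t] \<theta> \<open>0 < t\<close> False by simp
      obtain R P where "parametrix D T c r R P"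
        using param[OF \<open>0 < r\<close>] by blast
      then interpret parametrix D T c r R P .
      define w where "w = rem j l x"
      have w_dom: "w \<in> pow_dom D T n"
        unfolding w_def using x \<open>n < k\<close> by (intro rem_dom pow_dom_le[of x D T k n]) auto
      have b_dom: "x - w \<in> pow_dom D T m"
        unfolding w_def mj using x by (rule minus_rem_dom)
      have decay: "((\<Sum>i<j. c ^ i) * c / r) ^ l = a1 * t powr \<theta>"
        unfolding r_l[symmetric] by (simp add: a1_def power_divide)
      \<comment> \<open>Even the zeroth-order norm of \<open>w\<close> must decay like
        \<open>t powr \<theta>\<close>; \<open>l\<close> powers of \<open>T\<close> are spent on
        \<open>x\<close>, which \<open>C\<^sub>l\<close> pays for as
        \<open>l \<le> k\<close>.\<close>
      have "norm w \<le> a1 * t powr \<theta> * norm ((T ^^ l) x)"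
        using rem_decay[of x 0 l j, unfolded decay] pow_dom_le[OF x, of l] by (simp add: w_def kl)
      also have "\<dots> \<le> a1 * t powr \<theta> * (C\<^sub>l * N)"
        using C\<^sub>l[OF x] nonneg by (intro mult_left_mono) (simp_all add: N_def)
      finally have 1: "norm w \<le> a1 * C\<^sub>l * t powr \<theta> * N"
        by (simp add: mult_ac)
      have "norm ((T ^^ n) w) \<le> a1 * t powr \<theta> * norm ((T ^^ k) x)"
        using rem_decay[of x n l j, unfolded decay] x by (simp add: w_def kl)
      also have "\<dots> \<le> a1 * t powr \<theta> * N"
        using N nonneg by (intro mult_left_mono) simp_all
      finally have 2: "norm ((T ^^ n) w) \<le> a1 * t powr \<theta> * N" .
      have "norm (x - w) \<le> a2 * norm x"
        using norm_triangle_ineq4[of x w] rem_bound(2)[of x 0 j l] by (simp add: w_def a2_def algebra_simps)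
      then have "t * norm (x - w) \<le> t powr \<theta> * (a2 * N)"
        using t_le N nonneg \<open>0 < t\<close>
        by (intro mult_mono order_trans[OF _ mult_left_mono[of "norm x" N a2]]) auto
      then have 3: "t * norm (x - w) \<le> a2 * t powr \<theta> * N"
        by (simp add: mult_ac)
      have "norm ((T ^^ m) (x - w)) \<le> a3 * r ^ j * norm ((T ^^ k) x)"
        using minus_rem_smooth(2)[OF x, of j l] by (simp add: w_def mj a3_def power_mult_distrib mult.assoc)
      also have "\<dots> \<le> a3 * r ^ j * N"
        using N nonneg \<open>0 < r\<close> by (intro mult_left_mono) simp_all
      finally have "t * norm ((T ^^ m) (x - w)) \<le> t * (a3 * r ^ j * N)"
        using \<open>0 < t\<close> by simp
      also have "\<dots> = a3 * (t * r ^ j) * N"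
        by (simp add: mult_ac)
      finally have 4: "t * norm ((T ^^ m) (x - w)) \<le> a3 * t powr \<theta> * N"
        by (simp only: r_j)
      have "?K \<le> (a1 * C\<^sub>l + a1 + a2 + a3) * t powr \<theta> * N"
        using K_le[OF w_dom b_dom] 1 2 3 4 by (simp add: algebra_simps)
      also have "\<dots> \<le> C * t powr \<theta> * N"
        using N \<open>0 \<le> C\<^sub>n\<close> by (intro mult_right_mono) (simp_all add: C_def)
      finally show ?thesis by (simp add: N_def)
    qed
  qed
  then show ?thesis using \<open>0 \<le> C\<close> by blast
qed

theorem theorem3p7:
  fixes D :: "'a::right_quat_banach set" and T :: "'a \<Rightarrow> 'a"
    and \<omega> M :: real and n k m :: nat
  assumes "right_linear_op D T" and "closed_op D T"
    and "0 \<le> \<omega>" and "\<omega> \<le> pi"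
    and "quat_ray_set \<omega> \<subseteq> S_resolvent_set D T"
    and "0 \<le> M"
    and "\<And>s. s \<in> quat_ray_set \<omega> \<Longrightarrow> onorm (Q_inv D T s) \<le> M / (norm s)\<^sup>2"
    and "\<And>s. s \<in> quat_ray_set \<omega> \<Longrightarrow> onorm (T \<circ> Q_inv D T s) \<le> M / norm s"
    and "n < k" and "k < m"
  shows "pow_space D T k
           \<in> K_class ((real k - real n) / (real m - real n)) (pow_space D T n) (pow_space D T m)"
proof -
  have param: "\<exists>R P. parametrix D T (7 * M + 2) r R P" if r: "0 < r" for r
  proof -
    obtain s where "s \<in> quat_ray_set \<omega>" "norm s = r"
      using quat_ray_set_norm[OF r] by blast
    then show ?thesis
      using parametrix_of_S_resolvent[of D T s M] assms r by auto
  qed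
  \<comment> \<open>Completeness and embeddings need only one scale; the \<open>K\<close>-bound
    below draws on all scales through \<open>param\<close>.\<close>
  obtain R P where "parametrix D T (7 * M + 2) 1 R P"
    using param zero_less_one by blast
  then interpret parametrix D T "7 * M + 2" 1 R P .
  have "pow_space D T k \<hookrightarrow> sum_space (pow_space D T n) (pow_space D T m)"
    using \<open>n < k\<close>
    by (intro cont_embedded_sum_space cont_embedded_pow_space)
      (auto simp: subspace_0[OF pow_subspace] right_linear_op_pow_zero[OF lin])
  moreover have "inter_space (pow_space D T n) (pow_space D T m) \<hookrightarrow> pow_space D T k"
    using \<open>k < m\<close> by (intro cont_embedded_inter_space cont_embedded_pow_space) simp
  moreover have "interpolation_couple (pow_space D T n) (pow_space D T m)"
    by (simp add: interpolation_couple_def right_banach_pow_space[OF assms(2)] cont_in_ambient_pow_space)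
  moreover note right_banach_pow_space[OF assms(2), of k]
    K_functional_pow_space_bound[OF lin c_nonneg param \<open>n < k\<close> \<open>k < m\<close>]
  ultimately show ?thesis
    using \<open>n < k\<close> \<open>k < m\<close> by (simp add: K_class_def)
qed

end
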